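(* Let $n\ge 7$, let $\mathcal G$ be a connected bipartite cubic symmetric graph with $2n$ vertices, and let $H$ be the $n\times n$ parity-check matrix of the code $\mathcal C(\mathcal G)$. Suppose a codeword $c\in\mathcal C(\mathcal G)$ is sent through a binary symmetric channel with crossover probability $\rho$ and the vector $y$ is received. Let $w$ be the weight of the syndrome $s=y\cdot H^T\in\mathbb F_2^n$ of $y$. Then the variance of $w$ is $$\mathrm{Var}(w)=\frac{n}{2}\bigl(7f_6(\rho)-6f_4(\rho)\bigr),$$ where $f_t(\rho)=\dfrac{1-(1-2\rho)^t}{2}$.
   Context: All graphs are finite, without loops and multiple edges. A cubic symmetric graph is a $3$-regular graph that is arc-transitive, i.e. its automorphism group acts transitively on the set of arcs (ordered pairs of adjacent vertices). If $\mathcal G$ is a connected bipartite cubic symmetric graph with $2n$ vertices, order its vertices so that its adjacency matrix is $A=\begin{pmatrix}0&H\\H^T&0\end{pmatrix}$ with $H$ an $n\times n$ $(0,1)$-matrix. The code $\mathcal C(\mathcal G)$ is the binary linear code of length $n$ with parity-check matrix $H$, i.e. $\mathcal C(\mathcal G)=\{x\in\mathbb F_2^n : Hx^T=0\}$. A binary symmetric channel with crossover probability $\rho\in[0,1]$ flips each transmitted bit independently with probability $\rho$, so $y=c+e$ over $\mathbb F_2$, where the coordinates of $e$ are independent and each equals $1$ with probability $\rho$. The syndrome $s=(s_1,\dots,s_n)=yH^T$ is computed over $\mathbb F_2$, and its weight $w=\sum_{i=1}^n s_i$ is the integer number of coordinates equal to $1$. *)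

theory Defs
  imports
    "HOL-Probability.Probability"
    "HOL-Library.Z2"
    "Jordan_Normal_Form.Matrix"
    "Graph_Theory.Graph_Theory"
begin

hide_const (open) Finite_Cartesian_Product.vec Finite_Cartesian_Product.row
  Finite_Cartesian_Product.mat Finite_Cartesian_Product.transpose
hide_type (open) Finite_Cartesian_Product.vec

unbundle no vec_syntax

text \<open>
  A finite graph without loops and multiple edges is a \<^locale>\<open>pair_graph\<close>: each edge
  is represented by its two arcs, the ordered pairs of adjacent vertices.
\<close>

definition cubic :: "'a pair_pre_digraph \<Rightarrow> bool" where
  "cubic G \<longleftrightarrow> (\<forall>v \<in> pverts G. out_degree G v = 3)"

definition graph_automorphism ::
    "'a pair_pre_digraph \<Rightarrow> ('a, 'a \<times> 'a, 'a, 'a \<times> 'a) digraph_isomorphism \<Rightarrow> bool" where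
  "graph_automorphism G h \<longleftrightarrow>
     pre_digraph.digraph_isomorphism (with_proj G) h \<and> app_iso h (with_proj G) = with_proj G"

text \<open>
  As tail and head are preserved, \<^term>\<open>iso_arcs h\<close> maps an arc \<^term>\<open>(u, v)\<close> to
  \<^term>\<open>(iso_verts h u, iso_verts h v)\<close>.
\<close>

definition arc_transitive :: "'a pair_pre_digraph \<Rightarrow> bool" where
  "arc_transitive G \<longleftrightarrow>
     (\<forall>a \<in> parcs G. \<forall>b \<in> parcs G. \<exists>h. graph_automorphism G h \<and> iso_arcs h a = b)"

definition cubic_symmetric :: "'a pair_pre_digraph \<Rightarrow> bool" where
  "cubic_symmetric G \<longleftrightarrow> pair_graph G \<and> cubic G \<and> arc_transitive G"

definition bipartite :: "'a pair_pre_digraph \<Rightarrow> bool" where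
  "bipartite G \<longleftrightarrow>
     (\<exists>X Y. X \<union> Y = pverts G \<and> X \<inter> Y = {} \<and> parcs G \<subseteq> X \<times> Y \<union> Y \<times> X)"

text \<open>
  The (0,1)-matrices are taken directly over \<^typ>\<open>bit\<close>, the field with two elements.
\<close>

definition adjacency_mat :: "'a pair_pre_digraph \<Rightarrow> 'a list \<Rightarrow> bit mat" where
  "adjacency_mat G vs =
     mat (length vs) (length vs) (\<lambda>(i, j). if (vs ! i, vs ! j) \<in> parcs G then 1 else 0)"

text \<open>
  \<^term>\<open>H\<close> depends on the chosen ordering \<^term>\<open>vs\<close> of the vertices; any ordering that puts the
  adjacency matrix into block form is admitted.
\<close>

definition parity_check_mat :: "'a pair_pre_digraph \<Rightarrow> nat \<Rightarrow> bit mat \<Rightarrow> bool" where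
  "parity_check_mat G n H \<longleftrightarrow>
     H \<in> carrier_mat n n \<and>
     (\<exists>vs. distinct vs \<and> set vs = pverts G \<and>
        adjacency_mat G vs = four_block_mat (0\<^sub>m n n) H (transpose_mat H) (0\<^sub>m n n))"

definition code :: "bit mat \<Rightarrow> bit vec set" where
  "code H = {x \<in> carrier_vec (dim_col H). H *\<^sub>v x = 0\<^sub>v (dim_row H)}"

text \<open>
  \<^term>\<open>y\<close> is the output, as a random vector on \<^term>\<open>M\<close>, of a binary symmetric channel with
  crossover probability \<^term>\<open>\<rho>\<close> and input \<^term>\<open>c\<close>; the random vector \<^term>\<open>e\<close> is the error.
\<close>

definition bsc_output ::
    "'w measure \<Rightarrow> nat \<Rightarrow> real \<Rightarrow> bit vec \<Rightarrow> ('w \<Rightarrow> bit vec) \<Rightarrow> bool" where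
  "bsc_output M n \<rho> c y \<longleftrightarrow>
     (\<exists>e. (\<forall>\<omega> \<in> space M. e \<omega> \<in> carrier_vec n \<and> y \<omega> = c + e \<omega>) \<and>
          prob_space.indep_vars M (\<lambda>_. count_space UNIV) (\<lambda>i \<omega>. e \<omega> $ i) {..<n} \<and>
          (\<forall>i<n. measure M {\<omega> \<in> space M. e \<omega> $ i = 1} = \<rho>))"

text \<open>
  Vectors are columns here, so the row vector $y H^T$ is written \<^term>\<open>H *\<^sub>v y\<close>.
\<close>

definition syndrome :: "bit mat \<Rightarrow> bit vec \<Rightarrow> bit vec" where
  "syndrome H y = H *\<^sub>v y"

definition weight :: "bit vec \<Rightarrow> nat" where
  "weight s = card {i. i < dim_vec s \<and> s $ i = 1}"

definition f_par :: "nat \<Rightarrow> real \<Rightarrow> real" where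
  "f_par t \<rho> = (1 - (1 - 2 * \<rho>) ^ t) / 2"

end

theory Submission
  imports Defs
begin

text \<open>
  Put $q = 1 - 2\rho$ and replace every error bit by its sign, which has mean $q$. By
  multiplicativity the sign of the $i$-th syndrome bit is $\chi_i$, the product of the error signs
  over the support $R_i$ of row $i$ of $H$, and $w = \sum_i (1 - \chi_i)/2$. Signs square to one,
  so $\chi_i \chi_k$ is the product of the signs over the symmetric difference of $R_i$ and $R_k$,
  and independence gives
  \[ 4\,\mathrm{Var}(w) = \sum_{i,k} \bigl(q^{|R_i \triangle R_k|} - q^{|R_i| + |R_k|}\bigr) \]
  for every parity-check matrix (\<open>variance_syndrome_weight\<close>).

  The supports here are the neighbourhoods of the vertices in one part, so they have three elements,
  and everything depends on how they overlap. Diagonal terms contribute $1 - q^6$ each. If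
  distinct rows overlap in at most one position, the term of a pair $i \neq k$ is
  $|R_i \cap R_k| (q^4 - q^6)$. The overlaps of a fixed row with the others add up to
  $3 \cdot 2 = 6$, as every column has weight three too (\<open>sum_card_row_overlaps\<close>). Hence
  $4\,\mathrm{Var}(w) = n (1 + 6 q^4 - 7 q^6)$, which is the claimed value.

  Rows overlap in at most one position because the graph has no 4-cycle
  (\<open>card_common_nbrs_le_1\<close>). Indeed, the stabiliser of a vertex permutes its three neighbours
  transitively, hence also the three pairs of neighbours, each pair being the complement of
  a single neighbour. So one 4-cycle forces every path of length two to lie on a 4-cycle
  (\<open>cubic_symmetric_squares\<close>). Then vertices with a common neighbour have at least two; as two
  2-subsets of a 3-set meet, having a common neighbour is a transitive relation
  (\<open>common_nbr_trans\<close>). Its classes have at most six elements, and a connected graph consists of at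
  most two of them, so it has at most 12 vertices, fewer than $2n \geq 14$.
\<close>

section \<open>Cubic graphs in which every path of length two lies on a 4-cycle\<close>

locale cubic_with_squares =
  fixes E :: "'a rel"
  assumes sym: "sym E"
    and degree: "(u, v) \<in> E \<Longrightarrow> card (E `` {u}) = 3"
    and square: "\<lbrakk>(v, a) \<in> E; (v, b) \<in> E; a \<noteq> b\<rbrakk> \<Longrightarrow> \<exists>v'. v' \<noteq> v \<and> (a, v') \<in> E \<and> (b, v') \<in> E"
begin

lemma finite_nbrs: "finite (E `` {u})"
proof (cases "E `` {u} = {}")
  case False
  then have "card (E `` {u}) = 3" using degree by blast
  then show ?thesis by (metis card.infinite zero_neq_numeral)
qed simp

lemma two_common_nbrs:
  assumes "(v, a) \<in> E" "(v, b) \<in> E" "a \<noteq> b"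
  shows "2 \<le> card (E `` {a} \<inter> E `` {b})"
proof -
  obtain v' where v': "v' \<noteq> v" "(a, v') \<in> E" "(b, v') \<in> E" using square[OF assms] by blast
  have "{v, v'} \<subseteq> E `` {a} \<inter> E `` {b}" using assms v' sym by (auto dest: symD)
  then have "card {v, v'} \<le> card (E `` {a} \<inter> E `` {b})"
    using finite_nbrs by (intro card_mono) auto
  then show ?thesis using v' by simp
qed

text \<open>
  If both \<open>a\<close> and \<open>c\<close> have a neighbour in common with \<open>b\<close>, then each shares at least two of the
  three neighbours of \<open>b\<close>, and these two pairs intersect.
\<close>

lemma common_nbr_trans:
  assumes "b \<in> E `` (E `` {a})" "c \<in> E `` (E `` {b})"
  shows "c \<in> E `` (E `` {a})"
proof (cases "a = b \<or> b = c")
  case False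
  obtain x y where x: "(a, x) \<in> E" "(x, b) \<in> E" and y: "(b, y) \<in> E" "(y, c) \<in> E"
    using assms by blast
  let ?P = "E `` {a} \<inter> E `` {b}" and ?Q = "E `` {b} \<inter> E `` {c}"
  have P: "2 \<le> card ?P" using two_common_nbrs[of x a b] x sym False by (auto dest: symD)
  have Q: "2 \<le> card ?Q" using two_common_nbrs[of y b c] y sym False by (auto dest: symD)
  have "card (?P \<union> ?Q) \<le> card (E `` {b})" using finite_nbrs by (intro card_mono) auto
  then have "card (?P \<union> ?Q) \<le> 3" using degree y by simp
  moreover have "card ?P + card ?Q = card (?P \<union> ?Q) + card (?P \<inter> ?Q)"
    using finite_nbrs by (intro card_Un_Int) auto
  ultimately have "card (?P \<inter> ?Q) \<noteq> 0" using P Q by linarith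
  then have "?P \<inter> ?Q \<noteq> {}" by (metis card.empty)
  then show ?thesis using sym by (auto dest: symD)
qed (use assms in auto)

text \<open>
  Two of the neighbours of \<open>u\<close> together have at most four neighbours, because they share two; the
  third one adds at most two besides \<open>u\<close>. The sharp bound is four, attained by the 3-cube.
\<close>

lemma card_second_nbrs: "card (E `` (E `` {u})) \<le> 6"
proof (cases "E `` {u} = {}")
  case False
  then have "card (E `` {u}) = 3" using degree by blast
  then obtain a b c where abc: "E `` {u} = {a, b, c}" "a \<noteq> b" "b \<noteq> c" "a \<noteq> c"
    by (auto simp: card_3_iff)
  have nbr_back: "u \<in> E `` {x}" and card3: "card (E `` {x}) = 3" if "x \<in> {a, b, c}" for x
  proof -
    have "(u, x) \<in> E" using that abc by blast
    then show "u \<in> E `` {x}" using sym by (auto dest: symD)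
    then show "card (E `` {x}) = 3" using degree by blast
  qed
  have "E `` (E `` {u}) = E `` {a} \<union> E `` {b} \<union> (E `` {c} - {u})"
    unfolding abc(1) using nbr_back[of a] by auto
  then have "card (E `` (E `` {u})) \<le> card (E `` {a} \<union> E `` {b}) + card (E `` {c} - {u})"
    by (simp only: card_Un_le)
  moreover have "card (E `` {a}) + card (E `` {b}) =
      card (E `` {a} \<union> E `` {b}) + card (E `` {a} \<inter> E `` {b})"
    using finite_nbrs by (intro card_Un_Int)
  moreover have "2 \<le> card (E `` {a} \<inter> E `` {b})"
    by (rule two_common_nbrs[of u]) (use abc in blast)+
  moreover have "card (E `` {c} - {u}) = 2" using nbr_back[of c] card3[of c] finite_nbrs by simp
  ultimately show ?thesis using card3 by simp
qed simp

text \<open>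
  Along a walk the vertices fall alternately into the classes of \<open>u\<close> and of its neighbour \<open>w\<close>; this
  is where transitivity turns a local condition into a bound on the whole component.
\<close>

lemma reachable_second_nbr:
  assumes uw: "(u, w) \<in> E" and "(u, v) \<in> E\<^sup>*"
  shows "v \<in> E `` (E `` {u}) \<union> E `` (E `` {w})"
  using assms(2)
proof (induction rule: rtrancl_induct)
  case base
  then show ?case using uw sym by (auto dest: symD)
next
  case (step x y)
  have *: "y \<in> E `` (E `` {b})" if xa: "x \<in> E `` (E `` {a})" and ab: "(a, b) \<in> E" for a b
  proof -
    obtain z where z: "(a, z) \<in> E" "(z, x) \<in> E" using xa by blast
    have "z \<in> E `` (E `` {b})" using z ab sym by (auto dest: symD)
    moreover have "y \<in> E `` (E `` {z})" using z step by auto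
    ultimately show ?thesis by (rule common_nbr_trans)
  qed
  have wu: "(w, u) \<in> E" using uw sym by (auto dest: symD)
  from step.IH show ?case using *[OF _ uw] *[OF _ wu] by blast
qed

lemma card_le_12:
  assumes "(u, w) \<in> E" "V \<subseteq> E\<^sup>* `` {u}"
  shows "card V \<le> 12"
proof -
  have fin: "finite (E `` (E `` {x}))" for x
    using finite_nbrs by (metis finite_UN_I UN_singleton Image_UN)
  have "V \<subseteq> E `` (E `` {u}) \<union> E `` (E `` {w})"
    using reachable_second_nbr[OF assms(1)] assms(2) by blast
  then have "card V \<le> card (E `` (E `` {u}) \<union> E `` (E `` {w}))" using fin by (intro card_mono) auto
  also have "\<dots> \<le> card (E `` (E `` {u})) + card (E `` (E `` {w}))" by (rule card_Un_le)
  also have "\<dots> \<le> 6 + 6" using card_second_nbrs by (intro add_mono)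
  finally show ?thesis by simp
qed

end

section \<open>Common neighbours in cubic symmetric graphs\<close>

lemma pair_graph_sym: "pair_graph G \<Longrightarrow> sym (parcs G)"
  using pair_sym_digraph.pair_sym_arcs[OF pair_pseudo_graph.axioms(2)[OF pair_graph.axioms(2)]]
  by (simp add: symmetric_def)

lemma pair_graph_wf: "pair_graph G \<Longrightarrow> pair_wf_digraph G"
  by (rule pair_sym_digraph.axioms(1)[OF pair_pseudo_graph.axioms(2)[OF pair_graph.axioms(2)]])

lemma card_nbrs_cubic:
  assumes "cubic G" "v \<in> pverts G"
  shows "card (parcs G `` {v}) = 3"
proof -
  have "out_arcs (with_proj G) v = Pair v ` (parcs G `` {v})" by (auto simp: out_arcs_def)
  then have "out_degree (with_proj G) v = card (parcs G `` {v})"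
    by (simp add: out_degree_def card_image inj_on_def)
  then show ?thesis using assms by (simp add: cubic_def)
qed

lemma connected_reachable:
  assumes "pair_graph G" "Digraph_Component.connected (with_proj G)" "u \<in> pverts G" "v \<in> pverts G"
  shows "(u, v) \<in> (parcs G)\<^sup>*"
proof -
  have "u \<rightarrow>\<^sup>*\<^bsub>with_proj (mk_symmetric (with_proj G))\<^esub> v"
    using assms by (simp add: connected_def strongly_connected_def)
  moreover have "parcs (mk_symmetric (with_proj G)) = parcs G"
    using pair_graph_sym[OF assms(1)] by (auto simp: parcs_mk_symmetric dest: symD)
  ultimately show ?thesis by (auto simp: reachable_def dest: rtrancl_on_rtranclI)
qed

lemma
  assumes "graph_automorphism G h"
  shows automorphism_inj: "inj_on (iso_verts h) (pverts G)"
    and automorphism_arc: "(u, v) \<in> parcs G \<Longrightarrow> iso_arcs h (u, v) = (iso_verts h u, iso_verts h v)"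
    and automorphism_arc_in: "(u, v) \<in> parcs G \<Longrightarrow> (iso_verts h u, iso_verts h v) \<in> parcs G"
proof -
  have iso: "pre_digraph.digraph_isomorphism (with_proj G) h"
    and app: "app_iso h (with_proj G) = with_proj G"
    using assms by (auto simp: graph_automorphism_def)
  show "inj_on (iso_verts h) (pverts G)"
    using iso by (simp add: pre_digraph.digraph_isomorphism_def)
  have th: "iso_tail h = fst" "iso_head h = snd" and im: "iso_arcs h ` parcs G = parcs G"
    using arg_cong[OF app, of tail] arg_cong[OF app, of head] arg_cong[OF app, of arcs] by auto
  show arc: "iso_arcs h (u, v) = (iso_verts h u, iso_verts h v)" if "(u, v) \<in> parcs G"
    using iso that th by (auto simp: pre_digraph.digraph_isomorphism_def prod_eq_iff dest!: bspec)
  then show "(iso_verts h u, iso_verts h v) \<in> parcs G" if "(u, v) \<in> parcs G"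
    using im that by (metis imageI)
qed

text \<open>
  Automorphisms act transitively on the pairs consisting of a vertex \<open>v\<close> and an unordered pair of its
  neighbours: such a pair corresponds to the arc from \<open>v\<close> to the third neighbour. The 4-cycle
  through \<open>a\<close>, \<open>v\<close>, \<open>b\<close>, \<open>v'\<close> can therefore be moved onto any path of length two.
\<close>

lemma cubic_symmetric_squares:
  assumes G: "cubic_symmetric G"
    and va: "(v, a) \<in> parcs G" and vb: "(v, b) \<in> parcs G" and ab: "a \<noteq> b"
    and v': "v' \<noteq> v" "(a, v') \<in> parcs G" "(b, v') \<in> parcs G"
  shows "cubic_with_squares (parcs G)"
proof
  have pg: "pair_graph G" and cub: "cubic G" and trans: "arc_transitive G"
    using G by (auto simp: cubic_symmetric_def)
  interpret pair_wf_digraph G using pg by (rule pair_graph_wf)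
  show "sym (parcs G)" using pg by (rule pair_graph_sym)
  show deg: "card (parcs G `` {x}) = 3" if "(x, y) \<in> parcs G" for x y
    using card_nbrs_cubic[OF cub in_arcsD1[OF that]] .
  have fin: "finite (parcs G `` {x})" if "(x, y) \<in> parcs G" for x y
    using deg[OF that] by (metis card.infinite zero_neq_numeral)
  have third: "\<exists>r. parcs G `` {x} = {p, q, r} \<and> r \<noteq> p \<and> r \<noteq> q"
    if "(x, p) \<in> parcs G" "(x, q) \<in> parcs G" "p \<noteq> q" for x p q
  proof -
    have "card (parcs G `` {x} - {p, q}) = 1"
      using that deg[OF that(1)] fin[OF that(1)] by (subst card_Diff_subset) auto
    then obtain r where "parcs G `` {x} - {p, q} = {r}" by (auto simp: card_1_singleton_iff)
    then show ?thesis using that by (intro exI[of _ r]) blast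
  qed
  obtain c where c: "parcs G `` {v} = {a, b, c}" "c \<noteq> a" "c \<noteq> b" using third[OF va vb ab] by blast
  then have vc: "(v, c) \<in> parcs G" by blast
  fix x p q assume xp: "(x, p) \<in> parcs G" and xq: "(x, q) \<in> parcs G" and pq: "p \<noteq> q"
  obtain r where r: "parcs G `` {x} = {p, q, r}" "r \<noteq> p" "r \<noteq> q" using third[OF xp xq pq] by blast
  then have "(x, r) \<in> parcs G" by blast
  then obtain h where h: "graph_automorphism G h" and "iso_arcs h (v, c) = (x, r)"
    using trans vc by (auto simp: arc_transitive_def)
  let ?f = "iso_verts h"
  have f: "?f v = x" "?f c = r"
    using automorphism_arc[OF h vc] \<open>iso_arcs h (v, c) = (x, r)\<close> by auto
  have inj: "?f s = ?f t \<longleftrightarrow> s = t" if "s \<in> pverts G" "t \<in> pverts G" for s t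
    using automorphism_inj[OF h] that by (auto dest: inj_onD)
  have V: "v \<in> pverts G" "a \<in> pverts G" "b \<in> pverts G" "c \<in> pverts G" "v' \<in> pverts G"
    using va vb vc v' by (auto dest: wellformed')
  \<comment> \<open>The neighbour \<open>c\<close> goes to \<open>r\<close>, so the other two go to \<open>p\<close> and \<open>q\<close>, in an unknown order.\<close>
  have "{?f a, ?f b} \<subseteq> {p, q, r} - {r}"
    using automorphism_arc_in[OF h va] automorphism_arc_in[OF h vb] f r inj V c by blast
  moreover have "?f a \<noteq> ?f b" using inj V ab by simp
  ultimately have img: "?f a = p \<and> ?f b = q \<or> ?f a = q \<and> ?f b = p" by blast
  have "?f v' \<noteq> x" using f inj V v' by metis
  then show "\<exists>x'. x' \<noteq> x \<and> (p, x') \<in> parcs G \<and> (q, x') \<in> parcs G"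
    using img automorphism_arc_in[OF h v'(2)] automorphism_arc_in[OF h v'(3)] by metis
qed

lemma card_common_nbrs_le_1:
  assumes G: "cubic_symmetric G" and conn: "Digraph_Component.connected (with_proj G)"
    and large: "12 < card (pverts G)"
    and uk: "u \<noteq> k"
  shows "card (parcs G `` {u} \<inter> parcs G `` {k}) \<le> 1"
proof (rule ccontr)
  assume "\<not> ?thesis"
  then obtain a b where ab: "a \<in> parcs G `` {u} \<inter> parcs G `` {k}"
    "b \<in> parcs G `` {u} \<inter> parcs G `` {k}" "a \<noteq> b"
    using card_le_Suc0_iff_eq[of "parcs G `` {u} \<inter> parcs G `` {k}"]
    by (cases "finite (parcs G `` {u} \<inter> parcs G `` {k})") auto
  have pg: "pair_graph G" using G by (simp add: cubic_symmetric_def)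
  interpret pair_wf_digraph G using pg by (rule pair_graph_wf)
  have "(a, k) \<in> parcs G" "(b, k) \<in> parcs G" using ab pair_graph_sym[OF pg] by (auto dest: symD)
  then interpret cubic_with_squares "parcs G"
    using cubic_symmetric_squares[OF G, of u a b k] ab uk by blast
  have ua: "(u, a) \<in> parcs G" using ab by blast
  then have "pverts G \<subseteq> (parcs G)\<^sup>* `` {u}"
    using connected_reachable[OF pg conn] in_arcsD1 by blast
  then have "card (pverts G) \<le> 12" by (rule card_le_12[OF ua])
  then show False using large by simp
qed

section \<open>Rows and columns of the parity-check matrix\<close>

definition row_support :: "bit mat \<Rightarrow> nat \<Rightarrow> nat set" where
  "row_support H i = {j. j < dim_col H \<and> H $$ (i, j) = 1}"

definition col_support :: "bit mat \<Rightarrow> nat \<Rightarrow> nat set" where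
  "col_support H j = {i. i < dim_row H \<and> H $$ (i, j) = 1}"

text \<open>
  Rows of the parity-check matrix are indexed by the first \<open>n\<close> vertices of the ordering (\<open>f\<close>) and
  columns by the last \<open>n\<close> (\<open>g\<close>).
\<close>

lemma parity_check_mat_nbrs:
  assumes pg: "pair_wf_digraph G" and H: "parity_check_mat G n H" and card: "card (pverts G) = 2 * n"
  obtains f g where "inj_on f {..<n}" "inj_on g {..<n}" "f ` {..<n} \<subseteq> pverts G" "g ` {..<n} \<subseteq> pverts G"
    "\<And>i. i < n \<Longrightarrow> parcs G `` {f i} = g ` row_support H i"
    "\<And>j. j < n \<Longrightarrow> parcs G `` {g j} = f ` col_support H j"
proof -
  interpret pair_wf_digraph G by (rule pg)
  obtain vs where vs: "distinct vs" "set vs = pverts G"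
    and A: "adjacency_mat G vs = four_block_mat (0\<^sub>m n n) H (transpose_mat H) (0\<^sub>m n n)"
    and Hc: "H \<in> carrier_mat n n"
    using H by (auto simp: parity_check_mat_def)
  have len: "length vs = n + n" using vs card by (metis distinct_card mult_2)
  have entry: "(vs ! i, vs ! j) \<in> parcs G \<longleftrightarrow>
      four_block_mat (0\<^sub>m n n) H (transpose_mat H) (0\<^sub>m n n) $$ (i, j) = 1"
    if "i < n + n" "j < n + n" for i j
    unfolding A[symmetric] using that by (simp add: adjacency_mat_def len)
  have nbrs: "parcs G `` {x} = (!) vs ` {k. k < n + n \<and> (x, vs ! k) \<in> parcs G}" for x
  proof (intro equalityI subsetI)
    fix z assume z: "z \<in> parcs G `` {x}"
    then have "z \<in> set vs" using in_arcsD2 vs(2) by blast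
    then obtain k where "k < n + n" "z = vs ! k" by (metis in_set_conv_nth len)
    then show "z \<in> (!) vs ` {k. k < n + n \<and> (x, vs ! k) \<in> parcs G}" using z by blast
  qed auto
  show thesis
  proof
    show "inj_on (\<lambda>i. vs ! i) {..<n}" "inj_on (\<lambda>j. vs ! (n + j)) {..<n}"
      using vs len by (auto simp: inj_on_def nth_eq_iff_index_eq)
    show "(\<lambda>i. vs ! i) ` {..<n} \<subseteq> pverts G" "(\<lambda>j. vs ! (n + j)) ` {..<n} \<subseteq> pverts G"
      using vs len by (auto simp flip: vs(2))
    show "parcs G `` {vs ! i} = (\<lambda>j. vs ! (n + j)) ` row_support H i" if "i < n" for i
    proof -
      have "{k. k < n + n \<and> (vs ! i, vs ! k) \<in> parcs G} = (+) n ` row_support H i"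
      proof (intro equalityI subsetI)
        fix k assume "k \<in> {k. k < n + n \<and> (vs ! i, vs ! k) \<in> parcs G}"
        then have k: "k < n + n" "(vs ! i, vs ! k) \<in> parcs G" by auto
        then have "n \<le> k" "k - n \<in> row_support H i"
          using that Hc entry[of i k] by (auto simp: row_support_def split: if_splits)
        then show "k \<in> (+) n ` row_support H i" by (intro image_eqI[of _ _ "k - n"]) auto
      next
        fix k assume "k \<in> (+) n ` row_support H i"
        then obtain j where j: "k = n + j" "j < n" "H $$ (i, j) = 1"
          using Hc by (auto simp: row_support_def)
        then show "k \<in> {k. k < n + n \<and> (vs ! i, vs ! k) \<in> parcs G}"
          using that Hc entry[of i k] by simp
      qed
      then show ?thesis by (subst nbrs) (simp add: image_image)
    qed
    show "parcs G `` {vs ! (n + j)} = (\<lambda>i. vs ! i) ` col_support H j" if "j < n" for j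
    proof -
      have "{k. k < n + n \<and> (vs ! (n + j), vs ! k) \<in> parcs G} = col_support H j"
      proof (intro equalityI subsetI)
        fix k assume "k \<in> {k. k < n + n \<and> (vs ! (n + j), vs ! k) \<in> parcs G}"
        then have k: "k < n + n" "(vs ! (n + j), vs ! k) \<in> parcs G" by auto
        then show "k \<in> col_support H j"
          using that Hc entry[of "n + j" k] by (auto simp: col_support_def split: if_splits)
      next
        fix k assume "k \<in> col_support H j"
        then have k: "k < n" "H $$ (k, j) = 1" using Hc by (auto simp: col_support_def)
        then show "k \<in> {k. k < n + n \<and> (vs ! (n + j), vs ! k) \<in> parcs G}"
          using that Hc entry[of "n + j" k] by simp
      qed
      then show ?thesis by (subst nbrs) simp
    qed
  qed
qed

lemma parity_check_mat_supports:
  assumes G: "cubic_symmetric G" and conn: "Digraph_Component.connected (with_proj G)"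
    and H: "parity_check_mat G n H" and card: "card (pverts G) = 2 * n" and n: "7 \<le> n"
  shows "i < n \<Longrightarrow> card (row_support H i) = 3"
    and "j < n \<Longrightarrow> card (col_support H j) = 3"
    and "\<lbrakk>i < n; k < n; i \<noteq> k\<rbrakk> \<Longrightarrow> card (row_support H i \<inter> row_support H k) \<le> 1"
proof -
  have pg: "pair_graph G" and cub: "cubic G" using G by (auto simp: cubic_symmetric_def)
  obtain f g where fg: "inj_on f {..<n}" "inj_on g {..<n}" "f ` {..<n} \<subseteq> pverts G" "g ` {..<n} \<subseteq> pverts G"
    "\<And>i. i < n \<Longrightarrow> parcs G `` {f i} = g ` row_support H i"
    "\<And>j. j < n \<Longrightarrow> parcs G `` {g j} = f ` col_support H j"
    using parity_check_mat_nbrs[OF pair_graph_wf[OF pg] H card] by metis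
  have sub: "row_support H i \<subseteq> {..<n}" "col_support H j \<subseteq> {..<n}" for i j
    using H by (auto simp: row_support_def col_support_def parity_check_mat_def)
  show "card (row_support H i) = 3" if "i < n" for i
  proof -
    have "card (parcs G `` {f i}) = 3" using fg(3) that by (intro card_nbrs_cubic[OF cub]) auto
    then show ?thesis using fg(5)[OF that] inj_on_subset[OF fg(2) sub(1)] by (simp add: card_image)
  qed
  show "card (col_support H j) = 3" if "j < n" for j
  proof -
    have "card (parcs G `` {g j}) = 3" using fg(4) that by (intro card_nbrs_cubic[OF cub]) auto
    then show ?thesis using fg(6)[OF that] inj_on_subset[OF fg(1) sub(2)] by (simp add: card_image)
  qed
  show "card (row_support H i \<inter> row_support H k) \<le> 1" if ik: "i < n" "k < n" "i \<noteq> k" for i k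
  proof -
    have "f i \<noteq> f k" using fg(1) ik by (auto dest: inj_onD)
    then have "card (parcs G `` {f i} \<inter> parcs G `` {f k}) \<le> 1"
      using card n by (intro card_common_nbrs_le_1[OF G conn]) auto
    also have "parcs G `` {f i} \<inter> parcs G `` {f k} = g ` (row_support H i \<inter> row_support H k)"
      using ik fg(5) inj_on_image_Int[OF fg(2) sub(1) sub(1)] by simp
    also have "card \<dots> = card (row_support H i \<inter> row_support H k)"
      using inj_on_subset[OF fg(2), of "row_support H i \<inter> row_support H k"] sub
      by (intro card_image) blast
    finally show ?thesis .
  qed
qed

section \<open>Signs of binary symmetric noise\<close>

text \<open>
  The nontrivial additive character of the field with two elements: sums of bits become products of
  signs, whose expectation factorises under independence.
\<close>

definition bit_sign :: "bit \<Rightarrow> real" where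
  "bit_sign b = (if b = 1 then -1 else 1)"

lemma bit_sign_add: "bit_sign (a + b) = bit_sign a * bit_sign b"
  by (cases a; cases b) (auto simp: bit_sign_def)

lemma bit_sign_sum: "bit_sign (sum f A) = (\<Prod>x\<in>A. bit_sign (f x))"
  by (induction A rule: infinite_finite_induct) (auto simp: bit_sign_add, auto simp: bit_sign_def)

text \<open>The common factors cancel because a sign squares to one.\<close>

lemma prod_sign_mult:
  assumes "finite A" "finite B"
  shows "(\<Prod>j\<in>A. bit_sign (x j)) * (\<Prod>j\<in>B. bit_sign (x j)) =
    (\<Prod>j\<in>sym_diff A B. bit_sign (x j))"
proof -
  let ?s = "\<lambda>j. bit_sign (x j)"
  have A: "prod ?s A = prod ?s (A - B) * prod ?s (A \<inter> B)"
    using assms by (subst prod.union_disjoint[symmetric]) (auto intro!: prod.cong)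
  have B: "prod ?s B = prod ?s (B - A) * prod ?s (A \<inter> B)"
    using assms by (subst prod.union_disjoint[symmetric]) (auto intro!: prod.cong)
  have D: "prod ?s (sym_diff A B) = prod ?s (A - B) * prod ?s (B - A)"
    using assms by (intro prod.union_disjoint) auto
  have "prod ?s (A \<inter> B) * prod ?s (A \<inter> B) = 1"
    unfolding prod.distrib[symmetric] by (intro prod.neutral) (auto simp: bit_sign_def)
  then show ?thesis unfolding A B D by (simp add: algebra_simps)
qed

locale bsc_noise = prob_space M for M :: "'w measure" +
  fixes n :: nat and \<rho> :: real and e :: "nat \<Rightarrow> 'w \<Rightarrow> bit"
  assumes indep: "indep_vars (\<lambda>_. count_space UNIV) e {..<n}"
    and flip: "i < n \<Longrightarrow> prob {\<omega> \<in> space M. e i \<omega> = 1} = \<rho>"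
begin

definition sign_prod :: "nat set \<Rightarrow> 'w \<Rightarrow> real" where
  "sign_prod A \<omega> = (\<Prod>j\<in>A. bit_sign (e j \<omega>))"

lemma measurable_e: "i < n \<Longrightarrow> e i \<in> measurable M (count_space UNIV)"
  using indep by (auto simp: indep_vars_def)

lemma measurable_sign: "i < n \<Longrightarrow> (\<lambda>\<omega>. bit_sign (e i \<omega>)) \<in> borel_measurable M"
  by (rule measurable_compose[OF measurable_e]) auto

lemma integrable_sign: "i < n \<Longrightarrow> integrable M (\<lambda>\<omega>. bit_sign (e i \<omega>))"
  by (rule integrable_const_bound[of _ 1]) (simp add: bit_sign_def, rule measurable_sign)

lemma expectation_sign:
  assumes "i < n"
  shows "expectation (\<lambda>\<omega>. bit_sign (e i \<omega>)) = 1 - 2 * \<rho>"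
proof -
  define S where "S = {\<omega> \<in> space M. e i \<omega> = 1}"
  have S: "S \<in> events"
    using measurable_sets[OF measurable_e[OF assms], of "{1}"]
    by (simp add: S_def vimage_def Int_def conj_commute)
  have "expectation (\<lambda>\<omega>. bit_sign (e i \<omega>)) = expectation (\<lambda>\<omega>. 1 - 2 * indicator S \<omega>)"
    by (intro Bochner_Integration.integral_cong) (auto simp: bit_sign_def S_def)
  also have "\<dots> = 1 - 2 * prob S"
    using S integrable_real_indicator[OF S] by (subst Bochner_Integration.integral_diff) (auto simp: prob_space less_top[symmetric] emeasure_finite)
  finally show ?thesis using flip[OF assms] by (simp add: S_def)
qed

lemma
  assumes "A \<subseteq> {..<n}"
  shows integrable_sign_prod: "integrable M (sign_prod A)"
    and expectation_sign_prod: "expectation (sign_prod A) = (1 - 2 * \<rho>) ^ card A"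
proof -
  have fin: "finite A" using assms by (rule finite_subset) simp
  have "indep_vars (\<lambda>_. borel) (\<lambda>i \<omega>. bit_sign (e i \<omega>)) {..<n}"
    by (rule indep_vars_compose2[OF indep]) auto
  then have ind: "indep_vars (\<lambda>_. borel) (\<lambda>i \<omega>. bit_sign (e i \<omega>)) A"
    using assms by (rule indep_vars_subset)
  have int: "\<And>i. i \<in> A \<Longrightarrow> integrable M (\<lambda>\<omega>. bit_sign (e i \<omega>))"
    using assms by (auto intro: integrable_sign)
  show "integrable M (sign_prod A)" unfolding sign_prod_def by (rule indep_vars_integrable[OF fin ind int])
  have "expectation (sign_prod A) = (\<Prod>i\<in>A. expectation (\<lambda>\<omega>. bit_sign (e i \<omega>)))"
    unfolding sign_prod_def by (rule indep_vars_lebesgue_integral[OF fin ind int])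
  also have "\<dots> = (\<Prod>i\<in>A. 1 - 2 * \<rho>)"
    using assms by (intro prod.cong) (auto simp: expectation_sign)
  finally show "expectation (sign_prod A) = (1 - 2 * \<rho>) ^ card A" by simp
qed

lemma
  assumes "A \<subseteq> {..<n}" "B \<subseteq> {..<n}"
  shows integrable_sign_prod_mult: "integrable M (\<lambda>\<omega>. sign_prod A \<omega> * sign_prod B \<omega>)"
    and expectation_sign_prod_mult: "expectation (\<lambda>\<omega>. sign_prod A \<omega> * sign_prod B \<omega>)
      = (1 - 2 * \<rho>) ^ card (sym_diff A B)"
proof -
  have "finite A" "finite B" using assms by (auto intro: finite_subset)
  then have "(\<lambda>\<omega>. sign_prod A \<omega> * sign_prod B \<omega>) = sign_prod (sym_diff A B)"
    by (simp add: sign_prod_def prod_sign_mult fun_eq_iff)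
  moreover have "sym_diff A B \<subseteq> {..<n}" using assms by blast
  ultimately show "integrable M (\<lambda>\<omega>. sign_prod A \<omega> * sign_prod B \<omega>)"
    "expectation (\<lambda>\<omega>. sign_prod A \<omega> * sign_prod B \<omega>) = (1 - 2 * \<rho>) ^ card (sym_diff A B)"
    using integrable_sign_prod expectation_sign_prod by simp_all
qed

text \<open>
  Expanding the square of the centred sum leaves the covariances of the products of signs, divided by
  four because each product enters with the factor \<open>- 1 / 2\<close>.
\<close>

lemma variance_sum_sign_prod:
  assumes "finite I" and R: "\<And>i. i \<in> I \<Longrightarrow> R i \<subseteq> {..<n}"
  shows "variance (\<lambda>\<omega>. \<Sum>i\<in>I. (1 - sign_prod (R i) \<omega>) / 2) =
    (\<Sum>i\<in>I. \<Sum>k\<in>I. (1 - 2 * \<rho>) ^ card (sym_diff (R i) (R k))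
        - (1 - 2 * \<rho>) ^ (card (R i) + card (R k))) / 4"
proof -
  define q where "q = 1 - 2 * \<rho>"
  let ?d = "\<lambda>i \<omega>. sign_prod (R i) \<omega> - q ^ card (R i)"
  note [simp] = integrable_sign_prod[OF R] integrable_sign_prod_mult[OF R R] expectation_sign_prod[OF R, folded q_def]
    expectation_sign_prod_mult[OF R R, folded q_def]
  have mean: "expectation (\<lambda>\<omega>. \<Sum>i\<in>I. (1 - sign_prod (R i) \<omega>) / 2) = (\<Sum>i\<in>I. (1 - q ^ card (R i)) / 2)"
    by (simp add: prob_space cong: sum.cong)
  have sq: "((\<Sum>i\<in>I. (1 - sign_prod (R i) \<omega>) / 2) - (\<Sum>i\<in>I. (1 - q ^ card (R i)) / 2))\<^sup>2
      = (\<Sum>i\<in>I. \<Sum>k\<in>I. ?d i \<omega> * ?d k \<omega>) / 4" for \<omega>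
  proof -
    have "(\<Sum>i\<in>I. (1 - sign_prod (R i) \<omega>) / 2) - (\<Sum>i\<in>I. (1 - q ^ card (R i)) / 2) = - (\<Sum>i\<in>I. ?d i \<omega>) / 2"
      unfolding sum_subtractf[symmetric] sum_negf[symmetric] sum_divide_distrib
      by (intro sum.cong) (auto simp: field_simps)
    then show ?thesis by (simp add: power2_eq_square sum_product)
  qed
  have expand: "?d i \<omega> * ?d k \<omega> = sign_prod (R i) \<omega> * sign_prod (R k) \<omega> - q ^ card (R k) * sign_prod (R i) \<omega>
      - q ^ card (R i) * sign_prod (R k) \<omega> + q ^ card (R i) * q ^ card (R k)" for i k \<omega>
    by (simp add: algebra_simps)
  have int: "integrable M (\<lambda>\<omega>. ?d i \<omega> * ?d k \<omega>)"
    and ex: "expectation (\<lambda>\<omega>. ?d i \<omega> * ?d k \<omega>) =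
      q ^ card (sym_diff (R i) (R k)) - q ^ (card (R i) + card (R k))" if "i \<in> I" "k \<in> I" for i k
    unfolding expand using that by (simp_all add: prob_space power_add algebra_simps)
  have "variance (\<lambda>\<omega>. \<Sum>i\<in>I. (1 - sign_prod (R i) \<omega>) / 2)
      = (\<Sum>i\<in>I. \<Sum>k\<in>I. expectation (\<lambda>\<omega>. ?d i \<omega> * ?d k \<omega>)) / 4"
    unfolding mean sq using int by (simp add: Bochner_Integration.integral_sum)
  also have "\<dots> = (\<Sum>i\<in>I. \<Sum>k\<in>I. q ^ card (sym_diff (R i) (R k)) - q ^ (card (R i) + card (R k))) / 4"
    by (simp add: ex cong: sum.cong)
  finally show ?thesis unfolding q_def .
qed

end

section \<open>The syndrome weight\<close>

lemma bit_sign_mult_mat_vec: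
  assumes "H \<in> carrier_mat m n" "x \<in> carrier_vec n" "i < m"
  shows "bit_sign ((H *\<^sub>v x) $ i) = (\<Prod>j\<in>row_support H i. bit_sign (x $ j))"
proof -
  have "(H *\<^sub>v x) $ i = (\<Sum>j<n. H $$ (i, j) * x $ j)"
    using assms by (auto simp: scalar_prod_def atLeast0LessThan intro!: sum.cong)
  also have "\<dots> = (\<Sum>j\<in>row_support H i. H $$ (i, j) * x $ j)"
    using assms by (intro sum.mono_neutral_right) (auto simp: row_support_def)
  also have "\<dots> = (\<Sum>j\<in>row_support H i. x $ j)"
    by (intro sum.cong) (auto simp: row_support_def)
  finally show ?thesis by (simp add: bit_sign_sum)
qed

lemma weight_eq_sum: "real (weight s) = (\<Sum>i<dim_vec s. (1 - bit_sign (s $ i)) / 2)"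
proof -
  have "(\<Sum>i<dim_vec s. (1 - bit_sign (s $ i)) / 2) = (\<Sum>i<dim_vec s. if s $ i = 1 then 1 else 0)"
    by (intro sum.cong) (auto simp: bit_sign_def)
  also have "\<dots> = real (card ({..<dim_vec s} \<inter> {i. s $ i = 1}))"
    by (subst sum.inter_filter[symmetric]) (auto simp: Int_def)
  also have "{..<dim_vec s} \<inter> {i. s $ i = 1} = {i. i < dim_vec s \<and> s $ i = 1}" by auto
  finally show ?thesis by (simp add: weight_def)
qed

lemma syndrome_codeword_add:
  assumes "H \<in> carrier_mat m n" "c \<in> code H" "e \<in> carrier_vec n"
  shows "syndrome H (c + e) = H *\<^sub>v e"
  using assms by (auto simp: syndrome_def code_def mult_add_distrib_mat_vec)

lemma variance_syndrome_weight:
  assumes M: "prob_space M" and H: "H \<in> carrier_mat m n" and c: "c \<in> code H"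
    and bsc: "bsc_output M n \<rho> c y"
  shows "prob_space.variance M (\<lambda>\<omega>. real (weight (syndrome H (y \<omega>)))) =
    (\<Sum>i<m. \<Sum>k<m. (1 - 2 * \<rho>) ^ card (sym_diff (row_support H i) (row_support H k))
        - (1 - 2 * \<rho>) ^ (card (row_support H i) + card (row_support H k))) / 4"
proof -
  obtain e where e: "\<And>\<omega>. \<omega> \<in> space M \<Longrightarrow> e \<omega> \<in> carrier_vec n"
      "\<And>\<omega>. \<omega> \<in> space M \<Longrightarrow> y \<omega> = c + e \<omega>"
    and ind: "prob_space.indep_vars M (\<lambda>_. count_space UNIV) (\<lambda>i \<omega>. e \<omega> $ i) {..<n}"
    and flip: "\<And>i. i < n \<Longrightarrow> measure M {\<omega> \<in> space M. e \<omega> $ i = 1} = \<rho>"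
    using bsc by (auto simp: bsc_output_def)
  interpret prob_space M by (rule M)
  interpret bsc_noise M n \<rho> "\<lambda>i \<omega>. e \<omega> $ i" by unfold_locales (use ind flip in auto)
  have w: "real (weight (syndrome H (y \<omega>))) = (\<Sum>i<m. (1 - sign_prod (row_support H i) \<omega>) / 2)"
    if "\<omega> \<in> space M" for \<omega>
    using e[OF that] H
    by (simp add: weight_eq_sum syndrome_codeword_add[OF H c] sign_prod_def bit_sign_mult_mat_vec[OF H]
        del: index_mult_mat_vec)
  have "variance (\<lambda>\<omega>. real (weight (syndrome H (y \<omega>))))
      = variance (\<lambda>\<omega>. \<Sum>i<m. (1 - sign_prod (row_support H i) \<omega>) / 2)"
    using w by (simp cong: Bochner_Integration.integral_cong)
  also have "\<dots> = (\<Sum>i<m. \<Sum>k<m. (1 - 2 * \<rho>) ^ card (sym_diff (row_support H i) (row_support H k))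
        - (1 - 2 * \<rho>) ^ (card (row_support H i) + card (row_support H k))) / 4"
    using H by (intro variance_sum_sign_prod) (auto simp: row_support_def)
  finally show ?thesis .
qed

text \<open>
  Double counting of the pairs of another row and a position of row \<open>i\<close> where both have a one: each of
  the three positions occurs in two other rows.
\<close>

lemma sum_card_row_overlaps:
  assumes H: "H \<in> carrier_mat n n" and i: "i < n" and row: "card (row_support H i) = 3"
    and col: "\<And>j. j < n \<Longrightarrow> card (col_support H j) = 3"
  shows "(\<Sum>k\<in>{..<n} - {i}. card (row_support H i \<inter> row_support H k)) = 6"
proof -
  let ?R = "row_support H"
  have fin: "finite (?R i)" by (simp add: row_support_def)
  have "(\<Sum>k\<in>{..<n} - {i}. card (?R i \<inter> ?R k)) = (\<Sum>k\<in>{..<n} - {i}. \<Sum>j\<in>?R i. if j \<in> ?R k then 1 else 0)"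
    using fin by (intro sum.cong refl) (simp add: sum.If_cases)
  also have "\<dots> = (\<Sum>j\<in>?R i. \<Sum>k\<in>{..<n} - {i}. if j \<in> ?R k then 1 else 0)" by (rule sum.swap)
  also have "\<dots> = (\<Sum>j\<in>?R i. 2)"
  proof (intro sum.cong refl)
    fix j assume j: "j \<in> ?R i"
    have "(\<Sum>k\<in>{..<n} - {i}. if j \<in> ?R k then 1 else 0) = card (({..<n} - {i}) \<inter> {k. j \<in> ?R k})"
      by (simp add: sum.If_cases)
    also have "({..<n} - {i}) \<inter> {k. j \<in> ?R k} = col_support H j - {i}"
      using j H by (auto simp: row_support_def col_support_def)
    also have "card (col_support H j - {i}) = 2"
      using j i H col[of j] by (subst card_Diff_singleton) (auto simp: row_support_def col_support_def)
    finally show "(\<Sum>k\<in>{..<n} - {i}. if j \<in> ?R k then 1 else 0) = (2::nat)" .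
  qed
  also have "\<dots> = 6" using row by simp
  finally show ?thesis .
qed

theorem mainTheorem7:
  fixes G :: "'a pair_pre_digraph" and n :: nat and H :: "bit mat"
    and M :: "'w measure" and \<rho> :: real and c :: "bit vec" and y :: "'w \<Rightarrow> bit vec"
  assumes "n \<ge> 7"
    and "cubic_symmetric G" and "Digraph_Component.connected (with_proj G)" and "bipartite G"
    and "card (pverts G) = 2 * n"
    and "parity_check_mat G n H"
    and "c \<in> code H"
    and "prob_space M" and "0 \<le> \<rho>" and "\<rho> \<le> 1"
    and "bsc_output M n \<rho> c y"
  shows "prob_space.variance M (\<lambda>\<omega>. real (weight (syndrome H (y \<omega>))))
           = real n / 2 * (7 * f_par 6 \<rho> - 6 * f_par 4 \<rho>)"
proof -
  define q where "q = 1 - 2 * \<rho>"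
  let ?R = "row_support H"
  have H: "H \<in> carrier_mat n n" using assms(6) by (simp add: parity_check_mat_def)
  note supp = parity_check_mat_supports[OF assms(2,3,6,5,1)]
  \<comment> \<open>The exponent is \<open>6 - 2 * m\<close> for an overlap \<open>m\<close>; for \<open>m\<close> in \<open>{0, 1}\<close> the term is linear in \<open>m\<close>.\<close>
  have cov: "q ^ card (sym_diff (?R i) (?R k)) - q ^ (card (?R i) + card (?R k))
      = real (card (?R i \<inter> ?R k)) * (q ^ 4 - q ^ 6)" if ik: "i < n" "k < n" "k \<noteq> i" for i k
  proof -
    have fin: "finite (?R i)" "finite (?R k)" by (simp_all add: row_support_def)
    have "card (sym_diff (?R i) (?R k)) = card (?R i - ?R k) + card (?R k - ?R i)"
      using fin by (intro card_Un_disjoint) auto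
    moreover have "card (?R i - ?R k) = 3 - card (?R i \<inter> ?R k)"
      "card (?R k - ?R i) = 3 - card (?R i \<inter> ?R k)"
      using fin ik supp(1) by (simp_all add: card_Diff_subset_Int Int_commute)
    ultimately have "card (sym_diff (?R i) (?R k)) = 6 - 2 * card (?R i \<inter> ?R k)"
      by simp
    moreover have "card (?R i \<inter> ?R k) = 0 \<or> card (?R i \<inter> ?R k) = 1"
      using supp(3)[of i k] ik by linarith
    ultimately show ?thesis using supp(1) ik by auto
  qed
  have row: "(\<Sum>k<n. q ^ card (sym_diff (?R i) (?R k)) - q ^ (card (?R i) + card (?R k)))
      = 1 + 6 * q ^ 4 - 7 * q ^ 6" if i: "i < n" for i
  proof -
    let ?t = "\<lambda>k. q ^ card (sym_diff (?R i) (?R k)) - q ^ (card (?R i) + card (?R k))"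
    have "(\<Sum>k<n. ?t k) = ?t i + (\<Sum>k\<in>{..<n} - {i}. ?t k)"
      using i by (intro sum.remove) auto
    also have "?t i = 1 - q ^ 6" using supp(1)[OF i] by simp
    also have "(\<Sum>k\<in>{..<n} - {i}. ?t k)
        = (\<Sum>k\<in>{..<n} - {i}. real (card (?R i \<inter> ?R k)) * (q ^ 4 - q ^ 6))"
      using i by (intro sum.cong refl cov) auto
    also have "(1 - q ^ 6) + \<dots>
        = (1 - q ^ 6) + real (\<Sum>k\<in>{..<n} - {i}. card (?R i \<inter> ?R k)) * (q ^ 4 - q ^ 6)"
      by (simp add: sum_distrib_right)
    also have "(\<Sum>k\<in>{..<n} - {i}. card (?R i \<inter> ?R k)) = 6"
      using sum_card_row_overlaps[OF H i supp(1)[OF i] supp(2)] .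
    finally show ?thesis by simp
  qed
  have "prob_space.variance M (\<lambda>\<omega>. real (weight (syndrome H (y \<omega>))))
      = (\<Sum>i<n. 1 + 6 * q ^ 4 - 7 * q ^ 6) / 4"
    unfolding variance_syndrome_weight[OF assms(8) H assms(7,11)] q_def[symmetric]
    using row by simp
  also have "\<dots> = real n / 2 * (7 * f_par 6 \<rho> - 6 * f_par 4 \<rho>)"
  proof -
    have "f_par t \<rho> = (1 - q ^ t) / 2" for t by (simp add: f_par_def q_def)
    then show ?thesis by (simp only:) (simp add: field_simps)
  qed
  finally show ?thesis .
qed

end
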